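(* A cost vector $c\in\mathbb R^n$ is feasible for $\mathbf{QIO}(\mathcal K,\tau,\theta)$ (i.e. is the $c$-component of a feasible solution) if and only if there exists a feasible solution $(\bar v,\bar u,\{\bar\epsilon^k\}_{k\in\mathcal K})$ of the mixed-integer system (MIP) with $\bar v\neq 0$ such that $c\in\mathrm{cone}(\{a^i\}_{i:\bar v_i=1})$ and $\|c\|_p=1$.
   Context: Setting: $A\in\mathbb R^{m\times n}$, $b\in\mathbb R^m$, $\mathcal I=\{1,\dots,m\}$; $a^i\in\mathbb R^n$ is the $i$-th row of $A$ written as a column vector; prime denotes transpose. The forward feasible region $\mathcal X=\{x\in\mathbb R^n: Ax\ge b\}$ is bounded, full-dimensional and free of redundant constraints. Norm parameters $\ell,p\ge1$ (possibly $\infty$) are fixed, and $\|a^i\|_p=1$ for all $i$. The dataset $\hat{\mathcal X}=\{\hat x^1,\dots,\hat x^K\}\subset\mathbb R^n$ is indexed by $\mathcal K=\{1,\dots,K\}$, with no assumption on feasibility or optimality of the points. $\tau\ge0$ and $\theta\in[0,1]$. $\mathrm{cone}(\cdot)$ is the set of conic (nonnegative linear) combinations of the given vectors. Quantile inverse optimization problem $\mathbf{QIO}(\mathcal K,\tau,\theta)$: find $c\in\mathbb R^n$, $\{\epsilon^k\}_{k\in\mathcal K}\subset\mathbb R^n$, $y\in\mathbb R^m$, $\mathcal S\subseteq\mathcal K$ such that $A'y=c$, $y\ge0$; $A(\hat x^k-\epsilon^k)\ge b$, $c'(\hat x^k-\epsilon^k)=b'y$ and $\|\epsilon^k\|_\ell\le\tau$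 for all $k\in\mathcal S$; $|\mathcal S|\ge\theta K$; and $\|c\|_p=1$. System (MIP), in $v\in\{0,1\}^m$, $u\in\{0,1\}^K$, $\epsilon^k\in\mathbb R^n$ ($k\in\mathcal K$): $b_i\le {a^i}'(\hat x^k-\epsilon^k)\le b_i+M_1(1-v_i)$ for all $i\in\mathcal I,k\in\mathcal K$; $\|\epsilon^k\|_\ell\le\tau+M_2(1-u_k)$ for all $k\in\mathcal K$; $\sum_{k=1}^K u_k\ge\theta K$. Here $M_1,M_2$ are sufficiently large constants, i.e. $M_1\ge\max_{i\in\mathcal I,x\in\mathcal X}({a^i}'x-b_i)$ and $M_2\ge\max_{k\in\mathcal K,x\in\mathcal X}\|\hat x^k-x\|_\ell$, so the corresponding constraints are non-binding when $v_i=0$, respectively $u_k=0$. *)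

theory Defs
  imports "HOL-Analysis.Analysis"
begin

(* The l_p norm on R^n for 1 <= p <= infinity.  For finite p this uses "0 powr r = 0". *)
definition pnorm :: "ereal \<Rightarrow> real ^ 'n \<Rightarrow> real" where
  "pnorm p x =
     (if p = \<infinity> then infnorm x
      else (\<Sum>i\<in>UNIV. \<bar>x $ i\<bar> powr real_of_ereal p) powr (1 / real_of_ereal p))"

(* The empty combination is allowed, so the value at {} is {0}. *)
definition conic_combinations :: "'a::real_vector set \<Rightarrow> 'a set" where
  "conic_combinations W = {\<Sum>w\<in>F. r w *\<^sub>R w | F r. finite F \<and> F \<subseteq> W \<and> (\<forall>w\<in>F. 0 \<le> r w)}"

(* The order on "real ^ 'm" is componentwise. *)
definition feasible_region :: "real ^ 'n ^ 'm \<Rightarrow> real ^ 'm \<Rightarrow> (real ^ 'n) set" where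
  "feasible_region A b = {x. b \<le> A *v x}"

(* Dropping any single constraint enlarges the feasible region. *)
definition irredundant :: "real ^ 'n ^ 'm \<Rightarrow> real ^ 'm \<Rightarrow> bool" where
  "irredundant A b \<longleftrightarrow>
     (\<forall>i. {x. \<forall>j. j \<noteq> i \<longrightarrow> b $ j \<le> row j A \<bullet> x} \<noteq> feasible_region A b)"

(* The index set {1..K} of the data points is the finite type 'k, so K = CARD('k). *)
definition QIO_feasible ::
  "real ^ 'n ^ 'm \<Rightarrow> real ^ 'm \<Rightarrow> ('k::finite \<Rightarrow> real ^ 'n) \<Rightarrow> ereal \<Rightarrow> ereal \<Rightarrow> real \<Rightarrow> real
   \<Rightarrow> real ^ 'n \<Rightarrow> ('k \<Rightarrow> real ^ 'n) \<Rightarrow> real ^ 'm \<Rightarrow> 'k set \<Rightarrow> bool" where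
  "QIO_feasible A b xhat l p \<tau> \<theta> c \<epsilon> y S \<longleftrightarrow>
     transpose A *v y = c \<and> 0 \<le> y \<and>
     (\<forall>k\<in>S. b \<le> A *v (xhat k - \<epsilon> k) \<and> c \<bullet> (xhat k - \<epsilon> k) = b \<bullet> y \<and> pnorm l (\<epsilon> k) \<le> \<tau>) \<and>
     \<theta> * real CARD('k) \<le> real (card S) \<and>
     pnorm p c = 1"

definition MIP_feasible ::
  "real ^ 'n ^ 'm \<Rightarrow> real ^ 'm \<Rightarrow> ('k::finite \<Rightarrow> real ^ 'n) \<Rightarrow> ereal \<Rightarrow> real \<Rightarrow> real
   \<Rightarrow> real \<Rightarrow> real \<Rightarrow> real ^ 'm \<Rightarrow> real ^ 'k \<Rightarrow> ('k \<Rightarrow> real ^ 'n) \<Rightarrow> bool" where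
  "MIP_feasible A b xhat l \<tau> \<theta> M1 M2 v u \<epsilon> \<longleftrightarrow>
     (\<forall>i. v $ i \<in> {0, 1}) \<and> (\<forall>k. u $ k \<in> {0, 1}) \<and>
     (\<forall>i k. b $ i \<le> row i A \<bullet> (xhat k - \<epsilon> k) \<and>
            row i A \<bullet> (xhat k - \<epsilon> k) \<le> b $ i + M1 * (1 - v $ i)) \<and>
     (\<forall>k. pnorm l (\<epsilon> k) \<le> \<tau> + M2 * (1 - u $ k)) \<and>
     \<theta> * real CARD('k) \<le> (\<Sum>k\<in>UNIV. u $ k)"

end

theory Submission
  imports Defs
begin

text \<open>By complementary slackness, \<open>c = A'y\<close> with \<open>y \<ge> 0\<close> has zero duality gap at a feasible point
  exactly when every row in the support of \<open>y\<close> is tight there; so \<open>v\<close> is the indicator of the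
  support of \<open>y\<close>, and \<open>u\<close> that of \<open>S\<close>. The perturbations outside \<open>S\<close> must move their data points to
  a common optimal face too: any perturbed point from \<open>S\<close> serves as target, and when \<open>S = {}\<close>
  (possible for \<open>\<theta> = 0\<close>), where \<open>y\<close> need not be dual optimal, linear programming duality supplies
  both a target and a new \<open>y\<close>.\<close>

section \<open>Finitely generated convex cones\<close>

lemma convex_cone_sum:
  assumes "convex_cone C" and "\<And>i. i \<in> I \<Longrightarrow> f i \<in> C"
  shows "sum f I \<in> C"
  using assms(2)
  by (induction I rule: infinite_finite_induct)
    (simp_all add: convex_cone_contains_0[OF assms(1)] convex_cone_add[OF assms(1)])

text \<open>The set of sums is itself a convex cone containing the generators, and every convex cone
  containing them is closed under such sums. Coefficients are attached to indices, so a vector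
  listed twice may carry two of them.\<close>

lemma convex_cone_hull_finite_image:
  fixes f :: "'i \<Rightarrow> 'a::real_vector"
  assumes "finite J"
  shows "convex_cone hull (f ` J) = {\<Sum>j\<in>J. y j *\<^sub>R f j | y. \<forall>j\<in>J. (0::real) \<le> y j}"
    (is "_ = ?C")
proof
  have "f j \<in> ?C" if "j \<in> J" for j
  proof -
    have "f j = (\<Sum>i\<in>J. (if i = j then 1 else 0) *\<^sub>R f i)"
      using assms that by (simp add: if_distrib[of "\<lambda>t. t *\<^sub>R _"] cong: if_cong)
    then show ?thesis
      by (intro CollectI exI[of _ "\<lambda>i. if i = j then 1 else 0"]) auto
  qed
  moreover have "convex_cone ?C"
    unfolding convex_cone_iff
  proof (intro conjI ballI allI impI)
    show "0 \<in> ?C"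
      by (intro CollectI exI[of _ "\<lambda>_. 0"]) auto
  next
    fix x z assume "x \<in> ?C" "z \<in> ?C"
    then obtain r s where "x = (\<Sum>j\<in>J. r j *\<^sub>R f j)" "\<forall>j\<in>J. 0 \<le> r j"
      and "z = (\<Sum>j\<in>J. s j *\<^sub>R f j)" "\<forall>j\<in>J. 0 \<le> s j" by blast
    then show "x + z \<in> ?C"
      by (intro CollectI exI[of _ "\<lambda>j. r j + s j"]) (auto simp: scaleR_add_left sum.distrib)
  next
    fix x and t :: real assume "x \<in> ?C" "0 \<le> t"
    then obtain r where "x = (\<Sum>j\<in>J. r j *\<^sub>R f j)" "\<forall>j\<in>J. 0 \<le> r j" by blast
    with \<open>0 \<le> t\<close> show "t *\<^sub>R x \<in> ?C"
      by (intro CollectI exI[of _ "\<lambda>j. t * r j"]) (auto simp: scaleR_sum_right)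
  qed
  ultimately show "convex_cone hull (f ` J) \<subseteq> ?C"
    by (intro hull_minimal) auto
next
  show "?C \<subseteq> convex_cone hull (f ` J)"
    by (auto intro!: convex_cone_sum[OF convex_cone_convex_cone_hull] convex_cone_hull_mul
        intro: hull_inc)
qed

text \<open>Makes closedness and convexity of the hull available for the separation
  argument.\<close>

lemma conic_combinations_finite:
  assumes "finite W"
  shows "conic_combinations W = convex_cone hull W"
proof
  show "conic_combinations W \<subseteq> convex_cone hull W"
    unfolding conic_combinations_def
    by (auto intro!: convex_cone_sum[OF convex_cone_convex_cone_hull] convex_cone_hull_mul
        intro: hull_inc)
  show "convex_cone hull W \<subseteq> conic_combinations W"
    using convex_cone_hull_finite_image[OF assms, of "\<lambda>w. w"] assms
    unfolding conic_combinations_def by auto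
qed

text \<open>Dictionary between cone membership and dual vectors: multipliers on the selected rows
  extend by zero to a vector over all rows. Coinciding rows cause no trouble, since multipliers are
  indexed by row number.\<close>

lemma conic_combinations_rows:
  fixes A :: "real ^ 'n ^ 'm"
  shows "conic_combinations {row i A | i. P i} =
    {transpose A *v y | y. 0 \<le> y \<and> (\<forall>i. \<not> P i \<longrightarrow> y $ i = 0)}"
proof -
  have *: "transpose A *v y = (\<Sum>i | P i. (y $ i) *\<^sub>R row i A)" if "\<forall>i. \<not> P i \<longrightarrow> y $ i = 0" for y
  proof -
    have "transpose A *v y = (\<Sum>i\<in>UNIV. (y $ i) *\<^sub>R row i A)"
      by (simp add: matrix_mult_sum scalar_mult_eq_scaleR)
    also have "\<dots> = (\<Sum>i | P i. (y $ i) *\<^sub>R row i A)"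
      using that by (intro sum.mono_neutral_right) auto
    finally show ?thesis .
  qed
  have rows: "{row i A | i. P i} = (\<lambda>i. row i A) ` {i. P i}"
    by auto
  have "conic_combinations {row i A | i. P i} =
      {\<Sum>i | P i. r i *\<^sub>R row i A | r. \<forall>i\<in>{i. P i}. 0 \<le> r i}"
    unfolding rows by (simp add: conic_combinations_finite convex_cone_hull_finite_image)
  also have "\<dots> = {transpose A *v y | y. 0 \<le> y \<and> (\<forall>i. \<not> P i \<longrightarrow> y $ i = 0)}" (is "?L = ?R")
  proof
    show "?L \<subseteq> ?R"
    proof
      fix c assume "c \<in> ?L"
      then obtain r where r: "c = (\<Sum>i | P i. r i *\<^sub>R row i A)" "\<forall>i. P i \<longrightarrow> 0 \<le> r i"
        by auto
      define y where "y = (\<chi> i. if P i then r i else 0)"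
      have y: "\<forall>i. \<not> P i \<longrightarrow> y $ i = 0" "0 \<le> y"
        using r(2) by (auto simp: y_def less_eq_vec_def)
      have "c = transpose A *v y"
        unfolding *[OF y(1)] r(1) by (rule sum.cong) (auto simp: y_def)
      with y show "c \<in> ?R" by blast
    qed
    show "?R \<subseteq> ?L"
      using * by (force simp: less_eq_vec_def)
  qed
  finally show ?thesis .
qed

section \<open>Linear programming duality on the feasible region\<close>

lemma less_eq_matrix_vector_iff:
  fixes A :: "real ^ 'n ^ 'm"
  shows "b \<le> A *v x \<longleftrightarrow> (\<forall>i. b $ i \<le> row i A \<bullet> x)"
  by (simp add: less_eq_vec_def matrix_vector_mul_component row_def)

lemma inner_transpose_mult:
  fixes A :: "real ^ 'n ^ 'm"
  shows "(transpose A *v y) \<bullet> x = (\<Sum>i\<in>UNIV. y $ i * (row i A \<bullet> x))"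
  by (simp add: dot_lmul_matrix inner_vec_def[of y] matrix_vector_mul_component row_def)

text \<open>Minimality of \<open>x\<close> means that no feasible direction decreases the objective; if \<open>c\<close> were
  outside the closed cone of the active rows, a separating hyperplane would give such a direction.\<close>

lemma minimizer_in_active_cone:
  fixes A :: "real ^ 'n ^ 'm"
  assumes x: "x \<in> feasible_region A b"
    and min: "\<And>z. z \<in> feasible_region A b \<Longrightarrow> c \<bullet> x \<le> c \<bullet> z"
  shows "c \<in> conic_combinations {row i A | i. row i A \<bullet> x = b $ i}"
proof (rule ccontr)
  let ?I = "{row i A | i. row i A \<bullet> x = b $ i}"
  define C where "C = convex_cone hull ?I"
  have "finite ?I" by simp
  assume "c \<notin> conic_combinations ?I"
  then have "c \<notin> C"
    using conic_combinations_finite[OF \<open>finite ?I\<close>] by (simp add: C_def)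
  moreover have "closed C" "convex C"
    unfolding C_def using closed_convex_cone_hull[OF \<open>finite ?I\<close>] convex_convex_cone_hull by auto
  ultimately obtain d \<beta> where d: "d \<bullet> c < \<beta>" "\<And>z. z \<in> C \<Longrightarrow> \<beta> < d \<bullet> z"
    using separating_hyperplane_closed_point by metis
  have "\<beta> < 0"
    using d(2)[of 0] convex_cone_hull_contains_0[of ?I] by (simp add: C_def)
  have active: "0 \<le> d \<bullet> row i A" if "row i A \<bullet> x = b $ i" for i
  proof (rule ccontr)
    assume neg: "\<not> 0 \<le> d \<bullet> row i A"
    \<comment> \<open>With this scaling, \<open>t *\<^sub>R row i A\<close> lies in the cone and has
      inner product exactly \<beta> with \<open>d\<close>, against the strict separation.\<close>
    define t where "t = \<beta> / (d \<bullet> row i A)"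
    have "0 \<le> t"
      using neg \<open>\<beta> < 0\<close> by (simp add: t_def divide_nonpos_nonpos)
    then have "t *\<^sub>R row i A \<in> C"
      unfolding C_def using that by (intro convex_cone_hull_mul hull_inc) auto
    with d(2) have "\<beta> < t * (d \<bullet> row i A)" by fastforce
    with neg show False by (simp add: t_def)
  qed
  \<comment> \<open>A row active at \<open>x\<close> does not decrease along \<open>d\<close>; an
    inactive one has slack and survives a short step by continuity. As there are finitely many rows,
    one positive step length serves them all.\<close>
  have "\<forall>\<^sub>F t in at_right 0. b $ i \<le> row i A \<bullet> (x + t *\<^sub>R d)" for i
  proof (cases "row i A \<bullet> x = b $ i")
    case True
    then show ?thesis
      using active[OF True] eventually_at_right_less[of "0::real"]
      by (auto elim!: eventually_mono simp: inner_add_right inner_commute)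
  next
    case False
    have "((\<lambda>t. row i A \<bullet> (x + t *\<^sub>R d)) \<longlongrightarrow> row i A \<bullet> (x + 0 *\<^sub>R d)) (at_right 0)"
      by (intro tendsto_intros)
    moreover have "b $ i < row i A \<bullet> (x + 0 *\<^sub>R d)"
      using x False by (auto simp: feasible_region_def less_eq_matrix_vector_iff less_le)
    ultimately show ?thesis
      using order_tendstoD(1) by (fastforce elim: eventually_mono)
  qed
  then have "\<forall>\<^sub>F t in at_right (0::real). x + t *\<^sub>R d \<in> feasible_region A b \<and> 0 < t"
    by (auto simp: feasible_region_def less_eq_matrix_vector_iff eventually_all_finite
        eventually_conj_iff eventually_at_right_less)
  then obtain t where t: "x + t *\<^sub>R d \<in> feasible_region A b" "(0::real) < t"
    using eventually_happens trivial_limit_at_right_real by blast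
  have "t * (d \<bullet> c) < 0"
    using t(2) d(1) \<open>\<beta> < 0\<close> by (simp add: mult_pos_neg)
  with min[OF t(1)] show False
    by (simp add: inner_add_right inner_commute)
qed

lemma closed_feasible_region:
  fixes A :: "real ^ 'n ^ 'm"
  shows "closed (feasible_region A b)"
proof -
  have "feasible_region A b = (\<Inter>i. {x. row i A \<bullet> x \<ge> b $ i})"
    by (auto simp: feasible_region_def less_eq_matrix_vector_iff)
  then show ?thesis
    by (auto intro: closed_halfspace_ge)
qed

text \<open>The duality gap is the sum of the products of multiplier and slack. All are nonnegative,
  so the gap vanishes only if each product does.\<close>

lemma complementary_slackness:
  fixes A :: "real ^ 'n ^ 'm"
  assumes "b \<le> A *v x" and "0 \<le> y"
  shows "(transpose A *v y) \<bullet> x = b \<bullet> y \<longleftrightarrow> (\<forall>i. y $ i \<noteq> 0 \<longrightarrow> row i A \<bullet> x = b $ i)"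
proof -
  have "(transpose A *v y) \<bullet> x - b \<bullet> y = (\<Sum>i\<in>UNIV. y $ i * (row i A \<bullet> x - b $ i))"
    unfolding inner_transpose_mult
    by (simp add: inner_vec_def[of b] sum_subtractf right_diff_distrib mult.commute)
  moreover have "\<forall>i\<in>UNIV. 0 \<le> y $ i * (row i A \<bullet> x - b $ i)"
    using assms by (auto simp: less_eq_matrix_vector_iff less_eq_vec_def[of 0])
  ultimately have "(transpose A *v y) \<bullet> x = b \<bullet> y \<longleftrightarrow>
      (\<forall>i\<in>UNIV. y $ i * (row i A \<bullet> x - b $ i) = 0)"
    using sum_nonneg_eq_0_iff[of UNIV "\<lambda>i. y $ i * (row i A \<bullet> x - b $ i)"] by auto
  then show ?thesis by auto
qed

text \<open>Compactness gives a minimizer; its active rows generate \<open>c\<close>, and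
  multipliers supported on active rows leave no gap.\<close>

lemma linear_program_strong_duality:
  fixes A :: "real ^ 'n ^ 'm"
  assumes "bounded (feasible_region A b)" and "feasible_region A b \<noteq> {}"
  obtains x y where "x \<in> feasible_region A b" "0 \<le> y" "transpose A *v y = c" "c \<bullet> x = b \<bullet> y"
proof -
  have "compact (feasible_region A b)"
    using assms(1) by (simp add: compact_eq_bounded_closed closed_feasible_region)
  moreover have "continuous_on (feasible_region A b) (\<lambda>x. c \<bullet> x)"
    by (intro continuous_intros)
  ultimately obtain x where x: "x \<in> feasible_region A b" "\<And>z. z \<in> feasible_region A b \<Longrightarrow> c \<bullet> x \<le> c \<bullet> z"
    using continuous_attains_inf assms(2) by metis
  from minimizer_in_active_cone[OF this]
  obtain y where y: "c = transpose A *v y" "0 \<le> y" "\<forall>i. row i A \<bullet> x \<noteq> b $ i \<longrightarrow> y $ i = 0"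
    unfolding conic_combinations_rows by blast
  have "c \<bullet> x = b \<bullet> y"
    using x(1) y complementary_slackness[of b A x y] by (auto simp: feasible_region_def)
  with x(1) y that show thesis by blast
qed

section \<open>Equivalence of the inverse problem and the mixed-integer system\<close>

lemma pnorm_zero: "pnorm p 0 = 0"
  by (simp add: pnorm_def infnorm_eq_0)

theorem theorem1:
  fixes A :: "real ^ 'n ^ 'm" and b :: "real ^ 'm"
    and xhat :: "'k::finite \<Rightarrow> real ^ 'n"
    and l p :: ereal and \<tau> \<theta> M1 M2 :: real and c :: "real ^ 'n"
  assumes "bounded (feasible_region A b)"
    and "aff_dim (feasible_region A b) = int CARD('n)"
    and "irredundant A b"
    and "1 \<le> l" and "1 \<le> p"
    and "\<forall>i. pnorm p (row i A) = 1"
    and "0 \<le> \<tau>" and "0 \<le> \<theta>" and "\<theta> \<le> 1"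
    and "\<forall>i. \<forall>x\<in>feasible_region A b. row i A \<bullet> x - b $ i \<le> M1"
    and "\<forall>k. \<forall>x\<in>feasible_region A b. pnorm l (xhat k - x) \<le> M2"
  shows "(\<exists>\<epsilon> y S. QIO_feasible A b xhat l p \<tau> \<theta> c \<epsilon> y S) \<longleftrightarrow>
         (\<exists>v u \<epsilon>. MIP_feasible A b xhat l \<tau> \<theta> M1 M2 v u \<epsilon> \<and> v \<noteq> 0 \<and>
                  c \<in> conic_combinations {row i A | i. v $ i = 1} \<and> pnorm p c = 1)"
    (is "?QIO \<longleftrightarrow> ?MIP")
proof
  assume ?QIO
  then obtain \<epsilon> y S where Q: "QIO_feasible A b xhat l p \<tau> \<theta> c \<epsilon> y S" by blast
  obtain x0 y' where x0: "x0 \<in> feasible_region A b" and y': "0 \<le> y'" "transpose A *v y' = c"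
    and opt: "c \<bullet> x0 = b \<bullet> y'" and slack: "\<And>k. k \<in> S \<Longrightarrow> c \<bullet> (xhat k - \<epsilon> k) = b \<bullet> y'"
  proof (cases "S = {}")
    case True
    \<comment> \<open>The empty set has affine dimension -1.\<close>
    have "feasible_region A b \<noteq> {}"
      using assms(2) by auto
    from linear_program_strong_duality[OF assms(1) this] True that show thesis
      by (metis empty_iff)
  next
    case False
    then obtain k where "k \<in> S" by blast
    with Q that[of "xhat k - \<epsilon> k" y] show thesis
      by (simp add: QIO_feasible_def feasible_region_def)
  qed
  \<comment> \<open>The perturbed points are primary here; the perturbations are recovered as
    \<open>xhat k - x k\<close>, which agrees with \<open>\<epsilon> k\<close> on
    \<open>S\<close>.\<close>
  define x where "x k = (if k \<in> S then xhat k - \<epsilon> k else x0)" for k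
  define v :: "real ^ 'm" where "v = (\<chi> i. if y' $ i = 0 then 0 else 1)"
  define u :: "real ^ 'k" where "u = (\<chi> k. if k \<in> S then 1 else 0)"
  have xX: "x k \<in> feasible_region A b" for k
    using Q x0 by (simp add: x_def QIO_feasible_def feasible_region_def)
  \<comment> \<open>The gap is zero at every \<open>x k\<close>, by \<open>slack\<close> on
    \<open>S\<close> and by \<open>opt\<close> elsewhere, so a single \<open>v\<close> fits all data
    points.\<close>
  have tight: "row i A \<bullet> x k = b $ i" if "y' $ i \<noteq> 0" for i k
    using complementary_slackness[of b A "x k" y'] xX[of k] y' opt slack[of k] that
    by (auto simp: feasible_region_def x_def split: if_splits)
  have "MIP_feasible A b xhat l \<tau> \<theta> M1 M2 v u (\<lambda>k. xhat k - x k)"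
    unfolding MIP_feasible_def
  proof (intro conjI allI)
    fix i k
    show "b $ i \<le> row i A \<bullet> (xhat k - (xhat k - x k))"
      using xX[of k] by (simp add: feasible_region_def less_eq_matrix_vector_iff)
    show "row i A \<bullet> (xhat k - (xhat k - x k)) \<le> b $ i + M1 * (1 - v $ i)"
      using tight[of i k] assms(10) xX[of k] by (auto simp: v_def algebra_simps)
  next
    fix k
    \<comment> \<open>On \<open>S\<close> this is the bound from the inverse problem. Elsewhere
      \<open>x k\<close> is the feasible point \<open>x0\<close>, so \<open>M2\<close> alone bounds
      the norm, and adding \<tau> keeps the bound because \<tau> is nonnegative.\<close>
    show "pnorm l (xhat k - x k) \<le> \<tau> + M2 * (1 - u $ k)"
      using Q assms(7,11) x0 by (auto simp: u_def x_def QIO_feasible_def add_increasing)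
  next
    have "(\<Sum>k\<in>UNIV. u $ k) = real (card S)"
      by (simp add: u_def sum.If_cases)
    then show "\<theta> * real CARD('k) \<le> (\<Sum>k\<in>UNIV. u $ k)"
      using Q by (simp add: QIO_feasible_def)
  qed (auto simp: v_def u_def)
  moreover have "pnorm p c = 1"
    using Q by (simp add: QIO_feasible_def)
  \<comment> \<open>An empty support would force \<open>c = 0\<close>, which the normalization
    excludes.\<close>
  moreover have "v \<noteq> 0"
  proof
    assume "v = 0"
    then have "y' = 0"
      by (auto simp: v_def vec_eq_iff split: if_splits)
    then have "c = 0"
      using y' by simp
    with \<open>pnorm p c = 1\<close> show False
      by (simp add: pnorm_zero)
  qed
  moreover have "c \<in> conic_combinations {row i A | i. v $ i = 1}"
    unfolding conic_combinations_rows using y' by (auto simp: v_def)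
  ultimately show ?MIP by blast
next
  assume ?MIP
  then obtain v u \<epsilon> where M: "MIP_feasible A b xhat l \<tau> \<theta> M1 M2 v u \<epsilon>"
    and "c \<in> conic_combinations {row i A | i. v $ i = 1}" and "pnorm p c = 1" by blast
  then obtain y where y: "transpose A *v y = c" "0 \<le> y" "\<forall>i. v $ i \<noteq> 1 \<longrightarrow> y $ i = 0"
    unfolding conic_combinations_rows by blast
  define S where "S = {k. u $ k = 1}"
  have feas: "b \<le> A *v (xhat k - \<epsilon> k)" for k
    using M by (simp add: MIP_feasible_def less_eq_matrix_vector_iff)
  \<comment> \<open>On the support of \<open>y\<close> the term with \<open>M1\<close> vanishes, and
    the two bounds pinch the row to equality.\<close>
  have "row i A \<bullet> (xhat k - \<epsilon> k) = b $ i" if "y $ i \<noteq> 0" for i k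
  proof -
    have "v $ i = 1" using y(3) that by blast
    moreover have "b $ i \<le> row i A \<bullet> (xhat k - \<epsilon> k)"
      "row i A \<bullet> (xhat k - \<epsilon> k) \<le> b $ i + M1 * (1 - v $ i)"
      using M by (auto simp: MIP_feasible_def)
    ultimately show ?thesis by simp
  qed
  then have "c \<bullet> (xhat k - \<epsilon> k) = b \<bullet> y" for k
    using complementary_slackness[OF feas y(2)] y(1) by blast
  moreover have "pnorm l (\<epsilon> k) \<le> \<tau>" if "k \<in> S" for k
  proof -
    have "pnorm l (\<epsilon> k) \<le> \<tau> + M2 * (1 - u $ k)"
      using M by (simp add: MIP_feasible_def)
    with that show ?thesis by (simp add: S_def)
  qed
  moreover have "\<theta> * real CARD('k) \<le> real (card S)"
  proof -
    \<comment> \<open>Since \<open>u\<close> is binary, its sum counts \<open>S\<close>.\<close>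
    have "u $ k = (if k \<in> S then 1 else 0)" for k
      using M by (auto simp: MIP_feasible_def S_def)
    then have "(\<Sum>k\<in>UNIV. u $ k) = real (card S)"
      by (simp add: sum.If_cases)
    with M show ?thesis by (simp add: MIP_feasible_def)
  qed
  ultimately have "QIO_feasible A b xhat l p \<tau> \<theta> c \<epsilon> y S"
    using y feas \<open>pnorm p c = 1\<close> by (simp add: QIO_feasible_def)
  then show ?QIO by blast
qed

end
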